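(* Let $\delta,\widetilde\delta\in[0,1]$, and let $\mathcal E$, $\widetilde{\mathcal E}$, $\widehat{\mathcal E}$ be energy forms in separable complex Hilbert spaces $\mathscr H$, $\widetilde{\mathscr H}$, $\widehat{\mathscr H}$, with form domains $\mathscr H^1$, $\widetilde{\mathscr H}^1$, $\widehat{\mathscr H}^1$, respectively. Assume that $\mathcal E$ and $\widetilde{\mathcal E}$ are $\delta$-quasi-unitarily equivalent with identification operators $J$, $J^1$, $J'$ and $J^{\prime1}$, and that $\widetilde{\mathcal E}$ and $\widehat{\mathcal E}$ are $\widetilde\delta$-quasi-unitarily equivalent with identification operators $\widetilde J$, $\widetilde J^1$, $\widetilde J'$ and $\widetilde J^{\prime1}$. Assume in addition that, for all $f\in\mathscr H^1$ and $w\in\widehat{\mathscr H}^1$, $$\|J^1f\|_{\widetilde{\mathcal E}}\le(1+\delta)\|f\|_{\mathcal E}\quad\text{and}\quad\|\widetilde J^{\prime1}w\|_{\widetilde{\mathcal E}}\le(1+\widetilde\delta)\|w\|_{\widehat{\mathcal E}}.$$ Then $\mathcal E$ and $\widehat{\mathcal E}$ are $\widehat\delta$-quasi-unitarily equivalent with $\widehat\delta=14(\delta+\widetilde\delta)$.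
   Context: Energy forms. An energy form $\mathcal E$ in a separable complex Hilbert space $\mathscr H$ is a closed, non-negative, densely defined quadratic form, $\mathcal E(f)=\mathcal E(f,f)\ge 0$ for a sesquilinear form $\mathcal E:\mathscr H^1\times\mathscr H^1\to\mathbb C$ (same symbol), where $\mathscr H^1:=\operatorname{dom}\mathcal E$ is dense in $\mathscr H$ and is itself a Hilbert space with the norm $\|f\|_{\mathcal E}^2:=\|f\|_{\mathscr H}^2+\mathcal E(f)$. Similarly for $\widetilde{\mathcal E}$ in $\widetilde{\mathscr H}$ and $\widehat{\mathcal E}$ in $\widehat{\mathscr H}$. Quasi-unitary equivalence of forms. Let $\delta\ge0$. Two energy forms $\mathcal E$ (in $\mathscr H$, with domain $\mathscr H^1$) and $\widetilde{\mathcal E}$ (in $\widetilde{\mathscr H}$, with domain $\widetilde{\mathscr H}^1$) are called $\delta$-quasi-unitarily equivalent (with identification operators $J,J^1,J',J^{\prime1}$) if there are linear operators $J:\mathscr H\to\widetilde{\mathscr H}$, $J':\widetilde{\mathscr H}\to\mathscr H$, $J^1:\mathscr H^1\to\widetilde{\mathscr H}^1$, $J^{\prime1}:\widetilde{\mathscr H}^1\to\mathscr H^1$ such that (a) $\|Jf\|\le(1+\delta)\|f\|$ and $|\langle Jf,u\rangle-\langle f,J'u\rangle|\le\delta\|f\|\|u\|$ for all $f\in\mathscr H$, $u\in\widetilde{\mathscr H}$; (b) $\|f-J'Jf\|\le\delta\|f\|_{\mathcal E}$ and $\|u-JJ'u\|\le\delta\|u\|_{\widetilde{\mathcal E}}$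 for all $f\in\mathscr H^1$, $u\in\widetilde{\mathscr H}^1$; (c) $\|J^1f-Jf\|\le\delta\|f\|_{\mathcal E}$ and $\|J^{\prime1}u-J'u\|\le\delta\|u\|_{\widetilde{\mathcal E}}$ for all $f\in\mathscr H^1$, $u\in\widetilde{\mathscr H}^1$; (d) $|\widetilde{\mathcal E}(J^1f,u)-\mathcal E(f,J^{\prime1}u)|\le\delta\|f\|_{\mathcal E}\|u\|_{\widetilde{\mathcal E}}$ for all $f\in\mathscr H^1$, $u\in\widetilde{\mathscr H}^1$. (Norms and inner products without index are those of the Hilbert spaces $\mathscr H$ or $\widetilde{\mathscr H}$.) The same definition applies to the pairs $(\widetilde{\mathcal E},\widehat{\mathcal E})$ and $(\mathcal E,\widehat{\mathcal E})$. *)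

theory Defs
  imports "HOL-Analysis.Analysis"
begin

text \<open>
  Complex Hilbert spaces. The inner product is linear in the first and conjugate-linear
  in the second argument. The axiom \<open>cinner_self\<close> says that the inner product is positive
  definite (the norm being definite) and that the norm is the one it induces; completeness comes
  from the superclass \<open>banach\<close>.
\<close>

class chilbert_space = banach +
  fixes scaleC :: "complex \<Rightarrow> 'a \<Rightarrow> 'a" (infixr \<open>*\<^sub>C\<close> 75)
    and cinner :: "'a \<Rightarrow> 'a \<Rightarrow> complex"
  assumes scaleC_add_right: "a *\<^sub>C (x + y) = a *\<^sub>C x + a *\<^sub>C y"
    and scaleC_add_left: "(a + b) *\<^sub>C x = a *\<^sub>C x + b *\<^sub>C x"
    and scaleC_scaleC: "a *\<^sub>C b *\<^sub>C x = (a * b) *\<^sub>C x"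
    and scaleC_of_real: "complex_of_real r *\<^sub>C x = r *\<^sub>R x"
    and cinner_commute: "cinner x y = cnj (cinner y x)"
    and cinner_add_left: "cinner (x + y) z = cinner x z + cinner y z"
    and cinner_scaleC_left: "cinner (a *\<^sub>C x) y = a * cinner x y"
    and cinner_self: "cinner x x = complex_of_real ((norm x)\<^sup>2)"

interpretation complex_vector: vector_space "scaleC :: complex \<Rightarrow> 'a::chilbert_space \<Rightarrow> 'a"
proof
  show "1 *\<^sub>C x = x" for x :: 'a
    using scaleC_of_real[of 1 x] by simp
qed (simp_all add: scaleC_add_right scaleC_add_left scaleC_scaleC)

definition clinear_on ::
  "'a::chilbert_space set \<Rightarrow> ('a \<Rightarrow> 'b::chilbert_space) \<Rightarrow> bool" where
  "clinear_on D T \<longleftrightarrow>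
     (\<forall>f\<in>D. \<forall>g\<in>D. T (f + g) = T f + T g) \<and> (\<forall>a. \<forall>f\<in>D. T (a *\<^sub>C f) = a *\<^sub>C T f)"

definition sesquilinear_on ::
  "'a::chilbert_space set \<Rightarrow> ('a \<Rightarrow> 'a \<Rightarrow> complex) \<Rightarrow> bool" where
  "sesquilinear_on D E \<longleftrightarrow>
     (\<forall>f\<in>D. \<forall>g\<in>D. \<forall>h\<in>D. E (f + g) h = E f h + E g h \<and> E h (f + g) = E h f + E h g) \<and>
     (\<forall>a. \<forall>f\<in>D. \<forall>h\<in>D. E (a *\<^sub>C f) h = a * E f h \<and> E h (a *\<^sub>C f) = cnj a * E h f)"

text \<open>
  A form with domain \<open>D\<close> is encoded by \<open>D\<close> and a total function \<open>E\<close>, whose values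
  outside \<open>D \<times> D\<close> are irrelevant. Since \<open>E f f\<close> is real for \<open>f \<in> D\<close> in an energy form,
  taking its real part in the form norm loses nothing.
\<close>

definition form_norm :: "('a::chilbert_space \<Rightarrow> 'a \<Rightarrow> complex) \<Rightarrow> 'a \<Rightarrow> real" where
  "form_norm E f = sqrt ((norm f)\<^sup>2 + Re (E f f))"

text \<open>
  The last conjunct below is closedness of the form: \<open>D\<close> is complete with respect to the form norm.
\<close>

definition energy_form ::
  "'a::chilbert_space set \<Rightarrow> ('a \<Rightarrow> 'a \<Rightarrow> complex) \<Rightarrow> bool" where
  "energy_form D E \<longleftrightarrow>
     complex_vector.subspace D \<and>
     closure D = UNIV \<and>
     sesquilinear_on D E \<and>
     (\<forall>f\<in>D. E f f \<in> \<real> \<and> 0 \<le> Re (E f f)) \<and>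
     (\<forall>X::nat \<Rightarrow> 'a.
        (\<forall>n. X n \<in> D) \<and>
        (\<forall>e>0. \<exists>N. \<forall>m\<ge>N. \<forall>n\<ge>N. form_norm E (X m - X n) < e)
        \<longrightarrow> (\<exists>f\<in>D. (\<lambda>n. form_norm E (X n - f)) \<longlonglongrightarrow> 0))"

text \<open>
  \<open>J1\<close> and \<open>J'1\<close> are the operators between the form domains; only their values on \<open>D\<close> and
  \<open>D'\<close>, respectively, matter.
\<close>

definition quasi_unitarily_equivalent_with ::
  "real \<Rightarrow>
   'a::chilbert_space set \<Rightarrow> ('a \<Rightarrow> 'a \<Rightarrow> complex) \<Rightarrow>
   'b::chilbert_space set \<Rightarrow> ('b \<Rightarrow> 'b \<Rightarrow> complex) \<Rightarrow>
   ('a \<Rightarrow> 'b) \<Rightarrow> ('a \<Rightarrow> 'b) \<Rightarrow> ('b \<Rightarrow> 'a) \<Rightarrow> ('b \<Rightarrow> 'a) \<Rightarrow> bool" where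
  "quasi_unitarily_equivalent_with \<delta> D E D' E' J J1 J' J'1 \<longleftrightarrow>
     0 \<le> \<delta> \<and>
     clinear_on UNIV J \<and> clinear_on UNIV J' \<and>
     clinear_on D J1 \<and> J1 ` D \<subseteq> D' \<and>
     clinear_on D' J'1 \<and> J'1 ` D' \<subseteq> D \<and>
     (\<forall>f. norm (J f) \<le> (1 + \<delta>) * norm f) \<and>
     (\<forall>f u. cmod (cinner (J f) u - cinner f (J' u)) \<le> \<delta> * norm f * norm u) \<and>
     (\<forall>f\<in>D. norm (f - J' (J f)) \<le> \<delta> * form_norm E f) \<and>
     (\<forall>u\<in>D'. norm (u - J (J' u)) \<le> \<delta> * form_norm E' u) \<and>
     (\<forall>f\<in>D. norm (J1 f - J f) \<le> \<delta> * form_norm E f) \<and>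
     (\<forall>u\<in>D'. norm (J'1 u - J' u) \<le> \<delta> * form_norm E' u) \<and>
     (\<forall>f\<in>D. \<forall>u\<in>D'. cmod (E' (J1 f) u - E f (J'1 u)) \<le> \<delta> * form_norm E f * form_norm E' u)"

definition quasi_unitarily_equivalent ::
  "real \<Rightarrow>
   'a::chilbert_space set \<Rightarrow> ('a \<Rightarrow> 'a \<Rightarrow> complex) \<Rightarrow>
   'b::chilbert_space set \<Rightarrow> ('b \<Rightarrow> 'b \<Rightarrow> complex) \<Rightarrow> bool" where
  "quasi_unitarily_equivalent \<delta> D E D' E' \<longleftrightarrow>
     (\<exists>J J1 J' J'1. quasi_unitarily_equivalent_with \<delta> D E D' E' J J1 J' J'1)"

end

theory Submission
  imports Defs
begin

text \<open>
  Quasi-unitary equivalence is transitive, up to the constant, because the identification operators can be composed: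
  \<open>Jt \<circ> J\<close>, \<open>Jt1 \<circ> J1\<close>, \<open>J' \<circ> Jt'\<close> and \<open>J'1 \<circ> Jt'1\<close> work for the outer pair of forms. Each estimate
  follows by inserting a term at the intermediate space and using the triangle inequality. Two
  points need care.

  First, no bound on \<open>J'\<close> is part of the definition, but \<open>J'\<close> is \<open>\<delta>\<close>-close to the adjoint of \<open>J\<close>, so
  its norm is at most \<open>1 + 2 * \<delta>\<close> (\<open>norm_quasi_adjoint_le\<close>).

  Secondly, \<open>Jt' \<circ> Jt\<close> is close to the identity only on the form domain \<open>Dt\<close> and measured in the
  form norm, whereas \<open>J f\<close> need not lie in \<open>Dt\<close>. So \<open>J f\<close> is replaced by \<open>J1 f \<in> Dt\<close>, which is
  close to it and whose form norm is controlled by assumption; \<open>norm_minus_comp_le\<close> carries out the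
  replacement. The bound on \<open>Jt'1\<close> serves the opposite composition in the same way. Both bounds
  enter again where \<open>Jt1 \<circ> J1\<close> and \<open>J'1 \<circ> Jt'1\<close> are estimated, since the errors of the outer
  factors are measured in the form norm of the intermediate space.

  The constant 14 comes from \<open>f - J' (Jt' (Jt (J f)))\<close>, whose estimate is
  \<open>\<delta> + (1 + 2 * \<delta>) * (\<delta>t * (1 + \<delta>) + (1 + (1 + 2 * \<delta>t) * (1 + \<delta>t)) * \<delta>)\<close>; it equals
  \<open>28 = 14 * (1 + 1)\<close> at \<open>\<delta> = \<delta>t = 1\<close>. The other estimates leave room to spare.
\<close>

section \<open>The Cauchy--Schwarz inequality and near-adjoints\<close>

text \<open>
  The norm is already known to satisfy the triangle inequality, so expanding \<open>norm (x + y)\<close> gives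
  the real part of the inequality without a minimization argument.
\<close>

lemma Re_cinner_le:
  fixes x y :: "'a::chilbert_space"
  shows "Re (cinner x y) \<le> norm x * norm y"
proof -
  have add_right: "cinner z (x + y) = cinner z x + cinner z y" for z
    using cinner_commute[of z "x + y"] cinner_commute[of z x] cinner_commute[of z y]
    by (simp add: cinner_add_left)
  have "Re (cinner (x + y) (x + y)) = Re (cinner x x) + 2 * Re (cinner x y) + Re (cinner y y)"
    using cinner_commute[of y x] by (simp add: cinner_add_left add_right)
  hence "(norm (x + y))\<^sup>2 = (norm x)\<^sup>2 + 2 * Re (cinner x y) + (norm y)\<^sup>2"
    by (simp add: cinner_self)
  moreover have "(norm (x + y))\<^sup>2 \<le> (norm x + norm y)\<^sup>2"
    by (intro power_mono norm_triangle_ineq norm_ge_zero)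
  ultimately show ?thesis
    by (simp add: power2_sum)
qed

lemma norm_scaleC_unit:
  fixes x :: "'a::chilbert_space"
  assumes "cmod a = 1"
  shows "norm (a *\<^sub>C x) = norm x"
proof -
  have "cinner (a *\<^sub>C x) (a *\<^sub>C x) = a * cnj a * cinner x x"
    using cinner_commute[of x "a *\<^sub>C x"] cinner_commute[of x x]
    by (simp add: cinner_scaleC_left)
  also have "a * cnj a = 1"
    using assms complex_norm_square[of a] by simp
  finally have "(norm (a *\<^sub>C x))\<^sup>2 = (norm x)\<^sup>2"
    unfolding cinner_self by (simp only: mult_1_left of_real_eq_iff)
  thus ?thesis by simp
qed

lemma cinner_Cauchy_Schwarz:
  fixes x y :: "'a::chilbert_space"
  shows "cmod (cinner x y) \<le> norm x * norm y"
proof (cases "cinner x y = 0")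
  case False
  \<comment> \<open>Rotate \<open>x\<close> by the phase that makes the inner product real and positive.\<close>
  define a where "a = cnj (sgn (cinner x y))"
  have "a * cinner x y = complex_of_real (cmod (cinner x y))"
    using False complex_norm_square[of "cinner x y"]
    by (simp add: a_def sgn_eq field_simps power2_eq_square)
  hence "cmod (cinner x y) = Re (cinner (a *\<^sub>C x) y)"
    by (simp add: cinner_scaleC_left)
  also have "\<dots> \<le> norm (a *\<^sub>C x) * norm y"
    by (rule Re_cinner_le)
  also have "norm (a *\<^sub>C x) = norm x"
    using False by (intro norm_scaleC_unit) (simp add: a_def norm_sgn)
  finally show ?thesis .
qed simp

text \<open>Test the near-adjointness relation with \<open>f = J' u\<close>.\<close>

lemma norm_quasi_adjoint_le:
  fixes J :: "'a::chilbert_space \<Rightarrow> 'b::chilbert_space"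
  assumes "0 \<le> c" "0 \<le> \<delta>"
    and bound: "\<And>f. norm (J f) \<le> c * norm f"
    and adj: "\<And>f u. cmod (cinner (J f) u - cinner f (J' u)) \<le> \<delta> * norm f * norm u"
  shows "norm (J' u) \<le> (c + \<delta>) * norm u"
proof (cases "J' u = 0")
  case True
  with assms(1,2) show ?thesis by simp
next
  case False
  let ?f = "J' u"
  have "cmod (cinner (J ?f) u) \<le> c * norm ?f * norm u"
    using cinner_Cauchy_Schwarz[of "J ?f" u] mult_right_mono[OF bound[of ?f], of "norm u"]
    by simp
  moreover have "cmod (cinner ?f ?f) \<le> cmod (cinner (J ?f) u) +
      cmod (cinner (J ?f) u - cinner ?f ?f)"
    by (metis norm_triangle_sub norm_minus_commute)
  ultimately have "cmod (cinner ?f ?f) \<le> c * norm ?f * norm u + \<delta> * norm ?f * norm u"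
    using adj[of ?f u] by linarith
  hence "norm ?f * norm ?f \<le> norm ?f * ((c + \<delta>) * norm u)"
    by (simp add: cinner_self norm_mult power2_eq_square algebra_simps)
  thus ?thesis
    using False by simp
qed

section \<open>Composing almost inverse operators\<close>

lemma clinear_on_UNIV_diff:
  assumes "clinear_on UNIV T"
  shows "T (x - y) = T x - T y"
proof -
  have "T (x - y) + T y = T x"
    using assms unfolding clinear_on_def by (metis UNIV_I diff_add_cancel)
  thus ?thesis by (simp add: eq_diff_eq)
qed

lemma clinear_on_comp:
  assumes "clinear_on D T" "T ` D \<subseteq> D'" "clinear_on D' S"
  shows "clinear_on D (S \<circ> T)"
  using assms by (simp add: clinear_on_def image_subset_iff)

lemma form_norm_nonneg:
  assumes "energy_form D E" "f \<in> D"
  shows "0 \<le> form_norm E f"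
  using assms by (simp add: form_norm_def energy_form_def)

text \<open>
  Here \<open>P\<close> stands for a map such as \<open>Jt' \<circ> Jt\<close> that is close to the identity only at vectors like
  \<open>g\<close>; the vector \<open>h\<close> of interest is compared with such a \<open>g\<close>, at the price of the factor \<open>1 + \<beta>\<close>
  because both \<open>g - h\<close> and \<open>P (g - h)\<close> have to be estimated.
\<close>

lemma norm_minus_comp_le:
  assumes A_diff: "\<And>y z. A (y - z) = A y - A z"
    and A_bound: "\<And>y. norm (A y) \<le> \<alpha> * norm y" and "0 \<le> \<alpha>"
    and P_diff: "\<And>y z. P (y - z) = P y - P z"
    and P_bound: "\<And>y. norm (P y) \<le> \<beta> * norm y"
  shows "norm (x - A (P h)) \<le>
    norm (x - A h) + \<alpha> * (norm (g - P g) + (1 + \<beta>) * norm (g - h))"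
proof -
  have "h - P h = (g - P g) - (g - h) + P (g - h)"
    by (simp add: P_diff)
  hence "norm (h - P h) \<le> norm (g - P g) + norm (g - h) + norm (P (g - h))"
    by (metis norm_triangle_le norm_triangle_ineq4 add_mono order_refl)
  also have "\<dots> \<le> norm (g - P g) + (1 + \<beta>) * norm (g - h)"
    using P_bound[of "g - h"] by (simp add: algebra_simps)
  finally have "norm (A (h - P h)) \<le> \<alpha> * (norm (g - P g) + (1 + \<beta>) * norm (g - h))"
    using A_bound[of "h - P h"] mult_left_mono[OF _ \<open>0 \<le> \<alpha>\<close>] order_trans by blast
  moreover have "x - A (P h) = (x - A h) + A (h - P h)"
    by (simp add: A_diff)
  ultimately show ?thesis
    by (metis add_left_mono norm_triangle_ineq order_trans)
qed

lemma norm_diff_image_le: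
  assumes S_diff: "\<And>y z. S (y - z) = S y - S z"
    and S_bound: "\<And>y. norm (S y) \<le> \<sigma> * norm y"
  shows "norm (k - S h) \<le> norm (k - S g) + \<sigma> * norm (g - h)"
proof -
  have "k - S h = (k - S g) + S (g - h)"
    by (simp add: S_diff)
  thus ?thesis
    using S_bound[of "g - h"] by (metis add_left_mono norm_triangle_ineq order_trans)
qed

section \<open>Transitivity of quasi-unitary equivalence\<close>

theorem proposition1p6:
  fixes \<delta> \<delta>t :: real
    and D :: "'a::chilbert_space set" and E :: "'a \<Rightarrow> 'a \<Rightarrow> complex"
    and Dt :: "'b::chilbert_space set" and Et :: "'b \<Rightarrow> 'b \<Rightarrow> complex"
    and Dh :: "'c::chilbert_space set" and Eh :: "'c \<Rightarrow> 'c \<Rightarrow> complex"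
    and J J1 :: "'a \<Rightarrow> 'b" and J' J'1 :: "'b \<Rightarrow> 'a"
    and Jt Jt1 :: "'b \<Rightarrow> 'c" and Jt' Jt'1 :: "'c \<Rightarrow> 'b"
  assumes "\<delta> \<in> {0..1}" and "\<delta>t \<in> {0..1}"
    and "separable_space (euclidean :: 'a topology)"
    and "separable_space (euclidean :: 'b topology)"
    and "separable_space (euclidean :: 'c topology)"
    and "energy_form D E" and "energy_form Dt Et" and "energy_form Dh Eh"
    and "quasi_unitarily_equivalent_with \<delta> D E Dt Et J J1 J' J'1"
    and "quasi_unitarily_equivalent_with \<delta>t Dt Et Dh Eh Jt Jt1 Jt' Jt'1"
    and "\<And>f. f \<in> D \<Longrightarrow> form_norm Et (J1 f) \<le> (1 + \<delta>) * form_norm E f"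
    and "\<And>w. w \<in> Dh \<Longrightarrow> form_norm Et (Jt'1 w) \<le> (1 + \<delta>t) * form_norm Eh w"
  shows "quasi_unitarily_equivalent (14 * (\<delta> + \<delta>t)) D E Dh Eh"
proof -
  let ?d = "14 * (\<delta> + \<delta>t)"
  have d: "0 \<le> \<delta>" "\<delta> \<le> 1" and t: "0 \<le> \<delta>t" "\<delta>t \<le> 1"
    using assms(1,2) by auto
  have J_lin: "clinear_on UNIV J" and J'_lin: "clinear_on UNIV J'"
    and J1_lin: "clinear_on D J1" and J1_D: "J1 ` D \<subseteq> Dt"
    and J'1_lin: "clinear_on Dt J'1" and J'1_D: "J'1 ` Dt \<subseteq> D"
    and J_bound: "\<And>f. norm (J f) \<le> (1 + \<delta>) * norm f"
    and J_adj: "\<And>f u. cmod (cinner (J f) u - cinner f (J' u)) \<le> \<delta> * norm f * norm u"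
    and J'J: "\<And>f. f \<in> D \<Longrightarrow> norm (f - J' (J f)) \<le> \<delta> * form_norm E f"
    and JJ': "\<And>u. u \<in> Dt \<Longrightarrow> norm (u - J (J' u)) \<le> \<delta> * form_norm Et u"
    and J1_J: "\<And>f. f \<in> D \<Longrightarrow> norm (J1 f - J f) \<le> \<delta> * form_norm E f"
    and J'1_J': "\<And>u. u \<in> Dt \<Longrightarrow> norm (J'1 u - J' u) \<le> \<delta> * form_norm Et u"
    and J1_form: "\<And>f u. f \<in> D \<Longrightarrow> u \<in> Dt \<Longrightarrow>
      cmod (Et (J1 f) u - E f (J'1 u)) \<le> \<delta> * form_norm E f * form_norm Et u"
    using assms(9)[unfolded quasi_unitarily_equivalent_with_def] by blast+
  have Jt_lin: "clinear_on UNIV Jt" and Jt'_lin: "clinear_on UNIV Jt'"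
    and Jt1_lin: "clinear_on Dt Jt1" and Jt1_D: "Jt1 ` Dt \<subseteq> Dh"
    and Jt'1_lin: "clinear_on Dh Jt'1" and Jt'1_D: "Jt'1 ` Dh \<subseteq> Dt"
    and Jt_bound: "\<And>u. norm (Jt u) \<le> (1 + \<delta>t) * norm u"
    and Jt_adj: "\<And>u w. cmod (cinner (Jt u) w - cinner u (Jt' w)) \<le> \<delta>t * norm u * norm w"
    and Jt'Jt: "\<And>u. u \<in> Dt \<Longrightarrow> norm (u - Jt' (Jt u)) \<le> \<delta>t * form_norm Et u"
    and JtJt': "\<And>w. w \<in> Dh \<Longrightarrow> norm (w - Jt (Jt' w)) \<le> \<delta>t * form_norm Eh w"
    and Jt1_Jt: "\<And>u. u \<in> Dt \<Longrightarrow> norm (Jt1 u - Jt u) \<le> \<delta>t * form_norm Et u"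
    and Jt'1_Jt': "\<And>w. w \<in> Dh \<Longrightarrow> norm (Jt'1 w - Jt' w) \<le> \<delta>t * form_norm Eh w"
    and Jt1_form: "\<And>u w. u \<in> Dt \<Longrightarrow> w \<in> Dh \<Longrightarrow>
      cmod (Eh (Jt1 u) w - Et u (Jt'1 w)) \<le> \<delta>t * form_norm Et u * form_norm Eh w"
    using assms(10)[unfolded quasi_unitarily_equivalent_with_def] by blast+
  note diffs = J_lin[THEN clinear_on_UNIV_diff] J'_lin[THEN clinear_on_UNIV_diff]
    Jt_lin[THEN clinear_on_UNIV_diff] Jt'_lin[THEN clinear_on_UNIV_diff]
  have J'_bound: "norm (J' u) \<le> (1 + 2 * \<delta>) * norm u" for u
    using norm_quasi_adjoint_le[OF _ d(1) J_bound J_adj, of u] d by (simp add: algebra_simps)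
  have Jt'_bound: "norm (Jt' w) \<le> (1 + 2 * \<delta>t) * norm w" for w
    using norm_quasi_adjoint_le[OF _ t(1) Jt_bound Jt_adj, of w] t by (simp add: algebra_simps)
  note fn = form_norm_nonneg[OF assms(6)]
  note fnh = form_norm_nonneg[OF assms(8)]

  (* Every monomial containing both parameters is at most \<delta> * \<delta>t, hence at most \<delta> and at
     most \<delta>t; with these bounds the remaining comparisons of constants are linear. *)
  have mon: "0 \<le> \<delta> * \<delta>t" "\<delta> * \<delta>t \<le> \<delta>" "\<delta> * \<delta>t \<le> \<delta>t" "\<delta> * \<delta> \<le> \<delta>" "\<delta>t * \<delta>t \<le> \<delta>t"
    "\<delta> * (\<delta> * \<delta>t) \<le> \<delta> * \<delta>t" "\<delta> * (\<delta>t * \<delta>t) \<le> \<delta> * \<delta>t" "\<delta> * (\<delta> * (\<delta>t * \<delta>t)) \<le> \<delta> * \<delta>t"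
  proof -
    have *: "\<delta> * x \<le> x" "\<delta>t * x \<le> x" if "0 \<le> x" for x
      using mult_right_mono[OF d(2) that] mult_right_mono[OF t(2) that] by auto
    show "0 \<le> \<delta> * \<delta>t" "\<delta> * \<delta>t \<le> \<delta>t" "\<delta> * \<delta> \<le> \<delta>" "\<delta>t * \<delta>t \<le> \<delta>t"
      using *[of \<delta>] *[of \<delta>t] d t by auto
    show "\<delta> * \<delta>t \<le> \<delta>" using *(2)[of \<delta>] d by (simp add: mult.commute)
    show "\<delta> * (\<delta> * \<delta>t) \<le> \<delta> * \<delta>t" using *(1)[of "\<delta> * \<delta>t"] d t by auto
    show 1: "\<delta> * (\<delta>t * \<delta>t) \<le> \<delta> * \<delta>t" using *(2)[of \<delta>t] d t by (intro mult_left_mono) auto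
    show "\<delta> * (\<delta> * (\<delta>t * \<delta>t)) \<le> \<delta> * \<delta>t"
      using *(1)[of "\<delta> * (\<delta>t * \<delta>t)"] 1 d t by auto
  qed

  have c_bound: "(1 + \<delta>t) * (1 + \<delta>) \<le> 1 + ?d"
    and c_adj: "\<delta>t * (1 + \<delta>) + \<delta> * (1 + 2 * \<delta>t) \<le> ?d"
    and c_inv: "\<delta> + (1 + 2 * \<delta>) * (\<delta>t * (1 + \<delta>) + (1 + (1 + 2 * \<delta>t) * (1 + \<delta>t)) * \<delta>) \<le> ?d"
    and c_inv': "\<delta>t + (1 + \<delta>t) * (\<delta> * (1 + \<delta>t) + (1 + (1 + \<delta>) * (1 + 2 * \<delta>)) * \<delta>t) \<le> ?d"
    and c_one: "\<delta>t * (1 + \<delta>) + (1 + \<delta>t) * \<delta> \<le> ?d"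
    and c_one': "\<delta> * (1 + \<delta>t) + (1 + 2 * \<delta>) * \<delta>t \<le> ?d"
    and c_form: "\<delta>t * (1 + \<delta>) + \<delta> * (1 + \<delta>t) \<le> ?d"
    using mon d t by (simp_all add: algebra_simps)

  have bound: "norm (Jt (J f)) \<le> (1 + ?d) * norm f" for f
  proof -
    have "norm (Jt (J f)) \<le> (1 + \<delta>t) * ((1 + \<delta>) * norm f)"
      using Jt_bound[of "J f"] mult_left_mono[OF J_bound[of f], of "1 + \<delta>t"] t by linarith
    also have "\<dots> \<le> (1 + ?d) * norm f"
      using mult_right_mono[OF c_bound norm_ge_zero[of f]] by (simp only: mult.assoc)
    finally show ?thesis .
  qed

  have adj: "cmod (cinner (Jt (J f)) w - cinner f (J' (Jt' w))) \<le> ?d * norm f * norm w" for f w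
  proof -
    have "cmod (cinner (Jt (J f)) w - cinner f (J' (Jt' w)))
        \<le> cmod (cinner (Jt (J f)) w - cinner (J f) (Jt' w))
          + cmod (cinner (J f) (Jt' w) - cinner f (J' (Jt' w)))"
      using norm_triangle_ineq[of "cinner (Jt (J f)) w - cinner (J f) (Jt' w)"
          "cinner (J f) (Jt' w) - cinner f (J' (Jt' w))"] by simp
    also have "\<dots> \<le> \<delta>t * norm (J f) * norm w + \<delta> * norm f * norm (Jt' w)"
      by (intro add_mono Jt_adj J_adj)
    also have "\<dots> \<le> \<delta>t * ((1 + \<delta>) * norm f) * norm w + \<delta> * norm f * ((1 + 2 * \<delta>t) * norm w)"
      by (intro add_mono mult_left_mono mult_right_mono J_bound Jt'_bound) (use d t in auto)
    also have "\<dots> = (\<delta>t * (1 + \<delta>) + \<delta> * (1 + 2 * \<delta>t)) * (norm f * norm w)"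
      by (simp add: algebra_simps)
    also have "\<dots> \<le> ?d * (norm f * norm w)"
      by (intro mult_right_mono c_adj) auto
    finally show ?thesis by (simp only: mult.assoc)
  qed

  have inv: "norm (f - J' (Jt' (Jt (J f)))) \<le> ?d * form_norm E f" if f: "f \<in> D" for f
  proof -
    have P: "norm (Jt' (Jt u)) \<le> ((1 + 2 * \<delta>t) * (1 + \<delta>t)) * norm u" for u
      using Jt'_bound[of "Jt u"] mult_left_mono[OF Jt_bound[of u], of "1 + 2 * \<delta>t"] t
      by (simp only: mult.assoc) linarith
    have J1f: "J1 f \<in> Dt" using f J1_D by blast
    have "norm (J1 f - Jt' (Jt (J1 f))) \<le> \<delta>t * form_norm Et (J1 f)"
      by (rule Jt'Jt[OF J1f])
    also have "\<dots> \<le> \<delta>t * ((1 + \<delta>) * form_norm E f)"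
      by (intro mult_left_mono assms(11) f t)
    finally have 1: "norm (J1 f - Jt' (Jt (J1 f))) \<le> \<delta>t * ((1 + \<delta>) * form_norm E f)" .
    have "norm (f - J' (Jt' (Jt (J f)))) \<le> norm (f - J' (J f)) + (1 + 2 * \<delta>) *
        (norm (J1 f - Jt' (Jt (J1 f))) + (1 + (1 + 2 * \<delta>t) * (1 + \<delta>t)) * norm (J1 f - J f))"
      by (rule norm_minus_comp_le[where P = "\<lambda>u. Jt' (Jt u)"])
        (use J'_bound P d in \<open>simp_all add: diffs\<close>)
    also have "\<dots> \<le> \<delta> * form_norm E f + (1 + 2 * \<delta>) * (\<delta>t * ((1 + \<delta>) * form_norm E f)
        + (1 + (1 + 2 * \<delta>t) * (1 + \<delta>t)) * (\<delta> * form_norm E f))"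
      by (intro add_mono mult_left_mono 1 J'J J1_J f) (use d t in auto)
    also have "\<dots> = (\<delta> + (1 + 2 * \<delta>) * (\<delta>t * (1 + \<delta>) + (1 + (1 + 2 * \<delta>t) * (1 + \<delta>t)) * \<delta>))
        * form_norm E f"
      by (simp add: algebra_simps)
    also have "\<dots> \<le> ?d * form_norm E f"
      by (intro mult_right_mono c_inv fn f)
    finally show ?thesis .
  qed

  have inv': "norm (w - Jt (J (J' (Jt' w)))) \<le> ?d * form_norm Eh w" if w: "w \<in> Dh" for w
  proof -
    have P: "norm (J (J' u)) \<le> ((1 + \<delta>) * (1 + 2 * \<delta>)) * norm u" for u
      using J_bound[of "J' u"] mult_left_mono[OF J'_bound[of u], of "1 + \<delta>"] d
      by (simp only: mult.assoc) linarith
    have Jt'1w: "Jt'1 w \<in> Dt" using w Jt'1_D by blast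
    have "norm (Jt'1 w - J (J' (Jt'1 w))) \<le> \<delta> * form_norm Et (Jt'1 w)"
      by (rule JJ'[OF Jt'1w])
    also have "\<dots> \<le> \<delta> * ((1 + \<delta>t) * form_norm Eh w)"
      by (intro mult_left_mono assms(12) w d)
    finally have 1: "norm (Jt'1 w - J (J' (Jt'1 w))) \<le> \<delta> * ((1 + \<delta>t) * form_norm Eh w)" .
    have "norm (w - Jt (J (J' (Jt' w)))) \<le> norm (w - Jt (Jt' w)) + (1 + \<delta>t) *
        (norm (Jt'1 w - J (J' (Jt'1 w))) + (1 + (1 + \<delta>) * (1 + 2 * \<delta>)) * norm (Jt'1 w - Jt' w))"
      by (rule norm_minus_comp_le[where P = "\<lambda>u. J (J' u)"])
        (use Jt_bound P t in \<open>simp_all add: diffs\<close>)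
    also have "\<dots> \<le> \<delta>t * form_norm Eh w + (1 + \<delta>t) * (\<delta> * ((1 + \<delta>t) * form_norm Eh w)
        + (1 + (1 + \<delta>) * (1 + 2 * \<delta>)) * (\<delta>t * form_norm Eh w))"
      by (intro add_mono mult_left_mono 1 JtJt' Jt'1_Jt' w) (use d t in auto)
    also have "\<dots> = (\<delta>t + (1 + \<delta>t) * (\<delta> * (1 + \<delta>t) + (1 + (1 + \<delta>) * (1 + 2 * \<delta>)) * \<delta>t))
        * form_norm Eh w"
      by (simp add: algebra_simps)
    also have "\<dots> \<le> ?d * form_norm Eh w"
      by (intro mult_right_mono c_inv' fnh w)
    finally show ?thesis .
  qed

  have one: "norm (Jt1 (J1 f) - Jt (J f)) \<le> ?d * form_norm E f" if f: "f \<in> D" for f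
  proof -
    have J1f: "J1 f \<in> Dt" using f J1_D by blast
    have "norm (Jt1 (J1 f) - Jt (J f))
        \<le> norm (Jt1 (J1 f) - Jt (J1 f)) + (1 + \<delta>t) * norm (J1 f - J f)"
      by (rule norm_diff_image_le) (use Jt_bound in \<open>simp_all add: diffs\<close>)
    also have "\<dots> \<le> \<delta>t * form_norm Et (J1 f) + (1 + \<delta>t) * (\<delta> * form_norm E f)"
      by (intro add_mono mult_left_mono Jt1_Jt J1_J J1f f) (use t in auto)
    also have "\<dots> \<le> \<delta>t * ((1 + \<delta>) * form_norm E f) + (1 + \<delta>t) * (\<delta> * form_norm E f)"
      by (intro add_mono mult_left_mono assms(11) f t order_refl) (use t in auto)
    also have "\<dots> = (\<delta>t * (1 + \<delta>) + (1 + \<delta>t) * \<delta>) * form_norm E f"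
      by (simp add: algebra_simps)
    also have "\<dots> \<le> ?d * form_norm E f"
      by (intro mult_right_mono c_one fn f)
    finally show ?thesis .
  qed

  have one': "norm (J'1 (Jt'1 w) - J' (Jt' w)) \<le> ?d * form_norm Eh w" if w: "w \<in> Dh" for w
  proof -
    have Jt'1w: "Jt'1 w \<in> Dt" using w Jt'1_D by blast
    have "norm (J'1 (Jt'1 w) - J' (Jt' w))
        \<le> norm (J'1 (Jt'1 w) - J' (Jt'1 w)) + (1 + 2 * \<delta>) * norm (Jt'1 w - Jt' w)"
      by (rule norm_diff_image_le) (use J'_bound in \<open>simp_all add: diffs\<close>)
    also have "\<dots> \<le> \<delta> * form_norm Et (Jt'1 w) + (1 + 2 * \<delta>) * (\<delta>t * form_norm Eh w)"
      by (intro add_mono mult_left_mono J'1_J' Jt'1_Jt' Jt'1w w) (use d in auto)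
    also have "\<dots> \<le> \<delta> * ((1 + \<delta>t) * form_norm Eh w) + (1 + 2 * \<delta>) * (\<delta>t * form_norm Eh w)"
      by (intro add_mono mult_left_mono assms(12) w d order_refl) (use d in auto)
    also have "\<dots> = (\<delta> * (1 + \<delta>t) + (1 + 2 * \<delta>) * \<delta>t) * form_norm Eh w"
      by (simp add: algebra_simps)
    also have "\<dots> \<le> ?d * form_norm Eh w"
      by (intro mult_right_mono c_one' fnh w)
    finally show ?thesis .
  qed

  have form: "cmod (Eh (Jt1 (J1 f)) w - E f (J'1 (Jt'1 w))) \<le> ?d * form_norm E f * form_norm Eh w"
    if f: "f \<in> D" and w: "w \<in> Dh" for f w
  proof -
    have J1f: "J1 f \<in> Dt" using f J1_D by blast
    have Jt'1w: "Jt'1 w \<in> Dt" using w Jt'1_D by blast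
    have "cmod (Eh (Jt1 (J1 f)) w - E f (J'1 (Jt'1 w)))
        \<le> cmod (Eh (Jt1 (J1 f)) w - Et (J1 f) (Jt'1 w))
          + cmod (Et (J1 f) (Jt'1 w) - E f (J'1 (Jt'1 w)))"
      using norm_triangle_ineq[of "Eh (Jt1 (J1 f)) w - Et (J1 f) (Jt'1 w)"
          "Et (J1 f) (Jt'1 w) - E f (J'1 (Jt'1 w))"] by simp
    also have "\<dots> \<le> \<delta>t * form_norm Et (J1 f) * form_norm Eh w
        + \<delta> * form_norm E f * form_norm Et (Jt'1 w)"
      by (intro add_mono Jt1_form J1_form f w J1f Jt'1w)
    also have "\<dots> \<le> \<delta>t * ((1 + \<delta>) * form_norm E f) * form_norm Eh w
        + \<delta> * form_norm E f * ((1 + \<delta>t) * form_norm Eh w)"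
      by (intro add_mono mult_left_mono mult_right_mono assms(11,12) f w)
        (use d t fn[OF f] fnh[OF w] in auto)
    also have "\<dots> = (\<delta>t * (1 + \<delta>) + \<delta> * (1 + \<delta>t)) * (form_norm E f * form_norm Eh w)"
      by (simp add: algebra_simps)
    also have "\<dots> \<le> ?d * (form_norm E f * form_norm Eh w)"
      by (intro mult_right_mono c_form mult_nonneg_nonneg fn fnh f w)
    finally show ?thesis by (simp only: mult.assoc)
  qed

  have "quasi_unitarily_equivalent_with ?d D E Dh Eh (Jt \<circ> J) (Jt1 \<circ> J1) (J' \<circ> Jt') (J'1 \<circ> Jt'1)"
    unfolding quasi_unitarily_equivalent_with_def
  proof (intro conjI)
    show "clinear_on UNIV (Jt \<circ> J)" "clinear_on UNIV (J' \<circ> Jt')"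
      "clinear_on D (Jt1 \<circ> J1)" "clinear_on Dh (J'1 \<circ> Jt'1)"
      using clinear_on_comp[OF J_lin subset_UNIV Jt_lin]
        clinear_on_comp[OF Jt'_lin subset_UNIV J'_lin]
        clinear_on_comp[OF J1_lin J1_D Jt1_lin] clinear_on_comp[OF Jt'1_lin Jt'1_D J'1_lin]
      by blast+
    show "(Jt1 \<circ> J1) ` D \<subseteq> Dh" "(J'1 \<circ> Jt'1) ` Dh \<subseteq> D"
      using J1_D Jt1_D Jt'1_D J'1_D by (simp_all add: image_subset_iff)
  qed (use d t bound adj inv inv' one one' form in simp_all)
  thus ?thesis
    unfolding quasi_unitarily_equivalent_def by blast
qed

end
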